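(* Let $\mathcal{A} = (a_{i_1\cdots i_k})$ be a symmetric nonnegative tensor of order $k$ and dimension $n$. Then $\mathcal{A}$ has at most one H$^{++}$-eigenvalue. Moreover, let $(I_1,\dots,I_s)$ be the partition of $\{1,\dots,n\}$ described in the context, that is, a partition such that $\mathcal{A}(I_r)$ is weakly irreducible for $r=1,\dots,s$, and $a_{i_1\cdots i_k}=0$ for all $i_1\in I_r$ and $i_2,\dots,i_k\notin I_r$, $r=1,\dots,s$. Then a real number $\lambda$ is an H$^{++}$-eigenvalue of $\mathcal{A}$ if and only if $$\lambda = \lambda_{\max}(\mathcal{A}) = \lambda_{\max}(\mathcal{A}(I_r)) \quad\text{for } r = 1, \dots, s.$$
   Context: A real $k$th order $n$-dimensional tensor is an array $\mathcal{A}=(a_{i_1\cdots i_k})$ of real numbers, $i_1,\dots,i_k\in\{1,\dots,n\}$. It is symmetric if its entries are invariant under every permutation of the indices, and nonnegative if all its entries are nonnegative. For a vector $x$, $\mathcal{A}x^{k-1}$ is the $n$-dimensional vector with $i$th component $(\mathcal{A}x^{k-1})_i=\sum_{i_2,\dots,i_k=1}^n a_{ii_2\cdots i_k}x_{i_2}\cdots x_{i_k}$, and $x^{[k-1]}$ is the vector with $i$th component $x_i^{k-1}$. A real number $\lambda$ is an H-eigenvalue of $\mathcal{A}$ if there is a real nonzero vector $x\in\mathbb{R}^n$ (a corresponding H-eigenvector) with $\mathcal{A}x^{k-1}=\lambda x^{[k-1]}$; it is an H$^{++}$-eigenvalue if there is such an $x$ with all components strictly positive. $\lambda_{\max}(\mathcal{A})$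 denotes the largest H-eigenvalue of $\mathcal{A}$; for a nonnegative tensor it equals the spectral radius. For $I\subseteq\{1,\dots,n\}$, $\mathcal{A}(I)$ is the $k$th order $|I|$-dimensional tensor with entries $a_{i_1\cdots i_k}$, $i_1,\dots,i_k\in I$. Weak irreducibility: for a $k$th order $n$-dimensional symmetric nonnegative tensor $\mathcal{A}$, construct a graph $\hat G(\mathcal{A})=(\hat V,\hat E)$ with $\hat V=\bigcup_{j=1}^k V_j$, where each $V_j$ is a copy of $\{1,\dots,n\}$. For $i_j\in V_j$, $i_l\in V_l$, $j\ne l$, the edge $(i_j,i_l)$ belongs to $\hat E$ if and only if $a_{i_1\cdots i_k}\neq 0$ for some choice of the remaining $k-2$ indices $\{i_1,\dots,i_k\}\setminus\{i_j,i_l\}$. The tensor $\mathcal{A}$ is called weakly irreducible if $\hat G(\mathcal{A})$ is connected. (For $\mathcal{A}(I)$, the index set $\{1,\dots,n\}$ is replaced by $I$.) The partition: the paper takes from the literature that for a symmetric nonnegative tensor $\mathcal{A}$ of order $k$ and dimension $n$ there is a partition $(I_1,\dots,I_s)$ of $\{1,\dots,n\}$ such that $\mathcal{A}(I_r)$ is weakly irreducible for $r=1,\dots,s$, and $a_{i_1\cdots i_k}=0$ for all $i_1\in I_r$, $i_2,\dots,i_k\notin I_r$, $r=1,\dots,s$, and that furthermore $\lambda_{\max}(\mathcal{A})=\max\{\lambda_{\max}(\mathcal{A}(I_r)): r=1,\dots,s\}$. This is the partition used in the claim.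
   Formalization: The partition condition is taken as: a_{i_1...i_k}=0 whenever i_1 lies in I_r and at least one of i_2,...,i_k lies outside I_r (block diagonal). If it were required only when all of i_2,...,i_k lie outside I_r, the claim would be false for k=4 (a_1111=a_2222=1, permutations of 1122 equal to 1). *)

theory Defs
  imports Complex_Main "HOL-Combinatorics.Permutations" "HOL-Library.Disjoint_Sets"
begin

(* A tensor of order k over a finite index set N is a function on lists, of which only the
   values on the index tuples in "tuples k N" are relevant; likewise a vector is a function
   of which only the values on N are relevant. Hence the principal subtensor A(I) has the
   same entry function A, taken over the index set I. *)

type_synonym 'a tensor = "'a list \<Rightarrow> real"

definition tuples :: "nat \<Rightarrow> 'a set \<Rightarrow> 'a list set" where
  "tuples k N = {is. length is = k \<and> set is \<subseteq> N}"

definition symmetric_tensor :: "nat \<Rightarrow> 'a set \<Rightarrow> 'a tensor \<Rightarrow> bool" where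
  "symmetric_tensor k N A \<longleftrightarrow>
     (\<forall>is \<in> tuples k N. \<forall>\<sigma>. \<sigma> permutes {..<k} \<longrightarrow> A (permute_list \<sigma> is) = A is)"

definition nonneg_tensor :: "nat \<Rightarrow> 'a set \<Rightarrow> 'a tensor \<Rightarrow> bool" where
  "nonneg_tensor k N A \<longleftrightarrow> (\<forall>is \<in> tuples k N. 0 \<le> A is)"

definition tensor_apply :: "nat \<Rightarrow> 'a set \<Rightarrow> 'a tensor \<Rightarrow> ('a \<Rightarrow> real) \<Rightarrow> 'a \<Rightarrow> real" where
  "tensor_apply k N A x i = (\<Sum>is \<in> tuples (k - 1) N. A (i # is) * prod_list (map x is))"

definition H_eigenpair ::
    "nat \<Rightarrow> 'a set \<Rightarrow> 'a tensor \<Rightarrow> real \<Rightarrow> ('a \<Rightarrow> real) \<Rightarrow> bool" where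
  "H_eigenpair k N A \<mu> x \<longleftrightarrow>
     (\<exists>i \<in> N. x i \<noteq> 0) \<and> (\<forall>i \<in> N. tensor_apply k N A x i = \<mu> * x i ^ (k - 1))"

definition H_eigenvalue :: "nat \<Rightarrow> 'a set \<Rightarrow> 'a tensor \<Rightarrow> real \<Rightarrow> bool" where
  "H_eigenvalue k N A \<mu> \<longleftrightarrow> (\<exists>x. H_eigenpair k N A \<mu> x)"

definition Hpp_eigenvalue :: "nat \<Rightarrow> 'a set \<Rightarrow> 'a tensor \<Rightarrow> real \<Rightarrow> bool" where
  "Hpp_eigenvalue k N A \<mu> \<longleftrightarrow> (\<exists>x. H_eigenpair k N A \<mu> x \<and> (\<forall>i \<in> N. 0 < x i))"

definition lambda_max :: "nat \<Rightarrow> 'a set \<Rightarrow> 'a tensor \<Rightarrow> real" where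
  "lambda_max k N A = (GREATEST \<mu>. H_eigenvalue k N A \<mu>)"

(* The k-partite graph of a tensor: (j, p) is the element p of the j-th copy of N, with
   positions counted from 0. The edge relation is symmetric by construction. *)

definition tensor_graph_verts :: "nat \<Rightarrow> 'a set \<Rightarrow> (nat \<times> 'a) set" where
  "tensor_graph_verts k N = {..<k} \<times> N"

definition tensor_graph_edges ::
    "nat \<Rightarrow> 'a set \<Rightarrow> 'a tensor \<Rightarrow> ((nat \<times> 'a) \<times> (nat \<times> 'a)) set" where
  "tensor_graph_edges k N A =
     {((j, p), (l, q)) | j p l q. j < k \<and> l < k \<and> j \<noteq> l \<and>
        (\<exists>is \<in> tuples k N. is ! j = p \<and> is ! l = q \<and> A is \<noteq> 0)}"

(* In particular the zero tensor of dimension 1 and order at least 2 is not weakly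
   irreducible, as its graph consists of isolated vertices. *)

definition weakly_irreducible :: "nat \<Rightarrow> 'a set \<Rightarrow> 'a tensor \<Rightarrow> bool" where
  "weakly_irreducible k N A \<longleftrightarrow>
     (\<forall>u \<in> tensor_graph_verts k N. \<forall>v \<in> tensor_graph_verts k N.
        (u, v) \<in> (tensor_graph_edges k N A)\<^sup>*)"

(* The blocks I 1, ..., I s are nonempty (by partition_on) and pairwise disjoint (by
   partition_on and inj_on). The entry condition says that A has no nonzero entry
   with first index in a block and at least one other index outside it, i.e. A is block
   diagonal. Requiring this only when all other indices lie outside the block would be too
   weak: for k = 4, the tensor on {1,2} whose nonzero entries are a1111 = a2222 = 1 and
   those with indices a permutation of 1122, also 1, would have the blocks {1} and {2},
   each with largest H-eigenvalue 1, but the vector (1,1) belongs to the eigenvalue 4. *)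

definition weakly_irreducible_partition ::
    "nat \<Rightarrow> 'a set \<Rightarrow> 'a tensor \<Rightarrow> nat \<Rightarrow> (nat \<Rightarrow> 'a set) \<Rightarrow> bool" where
  "weakly_irreducible_partition k N A s I \<longleftrightarrow>
     partition_on N (I ` {1..s}) \<and> inj_on I {1..s} \<and>
     (\<forall>r \<in> {1..s}. weakly_irreducible k (I r) A) \<and>
     (\<forall>r \<in> {1..s}. \<forall>i \<in> I r. \<forall>is \<in> tuples (k - 1) N.
        \<not> set is \<subseteq> I r \<longrightarrow> A (i # is) = 0)"

end

theory Submission
  imports Defs "HOL-Analysis.Function_Topology"
begin

text \<open>A positive eigenvector dominates every other eigenvector up to scaling, so an
  H$^{++}$-eigenvalue is the largest H-eigenvalue; in particular it is unique. For a weakly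
  irreducible symmetric tensor such an eigenvalue exists: a maximizer of \<open>\<A>x\<^sup>k\<close> over
  nonnegative \<open>x\<close> with \<open>\<Sum>x\<^sub>i\<^sup>k = 1\<close> is positive, so it is a critical
  point. A positive eigenvector of a block diagonal tensor restricts to one of each block, and
  positive eigenvectors of all blocks with the same eigenvalue can be glued together.\<close>

section \<open>Index tuples and products over lists of indices\<close>

lemma finite_tuples [simp]: "finite N \<Longrightarrow> finite (tuples k N)"
  unfolding tuples_def using finite_lists_length_eq[of N k] by (simp add: conj_commute)

lemma tuples_mono: "M \<subseteq> N \<Longrightarrow> tuples k M \<subseteq> tuples k N"
  by (auto simp: tuples_def)

lemma tuples_Cons_iff: "k \<ge> 1 \<Longrightarrow> i # is \<in> tuples k N \<longleftrightarrow> i \<in> N \<and> is \<in> tuples (k - 1) N"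
  by (auto simp: tuples_def)

text \<open>Lists with equal multisets differ by a permutation of positions. This form of symmetry
  suits arguments that move a single index to the front.\<close>

lemma symmetric_tensor_mset_cong:
  assumes "symmetric_tensor k N A" "js \<in> tuples k N" "mset is = mset js"
  shows "A is = A js"
proof -
  obtain p where "p permutes {..<length js}" "permute_list p js = is"
    using mset_eq_permutation[OF assms(3)] by blast
  then show ?thesis
    using assms(1,2) unfolding symmetric_tensor_def tuples_def by auto
qed

lemma symmetric_tensor_subset:
  "symmetric_tensor k N A \<Longrightarrow> M \<subseteq> N \<Longrightarrow> symmetric_tensor k M A"
  using tuples_mono unfolding symmetric_tensor_def by blast

lemma nonneg_tensor_subset: "nonneg_tensor k N A \<Longrightarrow> M \<subseteq> N \<Longrightarrow> nonneg_tensor k M A"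
  using tuples_mono unfolding nonneg_tensor_def by blast

lemma prod_list_map_mono:
  fixes f g :: "'a \<Rightarrow> real"
  assumes "\<And>i. i \<in> set is \<Longrightarrow> 0 \<le> f i" "\<And>i. i \<in> set is \<Longrightarrow> f i \<le> g i"
  shows "prod_list (map f is) \<le> prod_list (map g is)"
  using assms
proof (induction "is")
  case (Cons a "is")
  moreover have "0 \<le> prod_list (map f is)"
    using Cons.prems by (intro prod_list_nonneg) auto
  ultimately show ?case
    by (auto intro!: mult_mono intro: order_trans)
qed simp

lemma prod_list_map_cmult:
  fixes f :: "'a \<Rightarrow> real"
  shows "prod_list (map (\<lambda>i. c * f i) is) = c ^ length is * prod_list (map f is)"
  by (induction "is") auto

lemma abs_prod_list_map:
  fixes f :: "'a \<Rightarrow> real"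
  shows "\<bar>prod_list (map f is)\<bar> = prod_list (map (\<lambda>i. \<bar>f i\<bar>) is)"
  by (induction "is") (auto simp: abs_mult)

lemma prod_list_map_if:
  fixes f g :: "'a \<Rightarrow> real"
  shows "prod_list (map (\<lambda>i. if P i then f i else g i) is) =
    prod_list (map f (filter P is)) * prod_list (map g (filter (\<lambda>i. \<not> P i) is))"
  by (induction "is") auto

lemma prod_list_map_pos:
  fixes f :: "'a \<Rightarrow> real"
  shows "(\<And>i. i \<in> set is \<Longrightarrow> 0 < f i) \<Longrightarrow> 0 < prod_list (map f is)"
  by (induction "is") auto

section \<open>Positive eigenvectors belong to the largest eigenvalue\<close>

text \<open>The Collatz--Wielandt argument: scale the positive eigenvector \<open>x\<close> by the least \<open>t\<close> with
  \<open>\<bar>y\<bar> \<le> t x\<close> and compare the two eigenvalue equations at an index where equality holds.\<close>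
lemma H_eigenvalue_le_of_positive_eigenvector:
  assumes fin: "finite N" and k: "k \<ge> 1" and nn: "nonneg_tensor k N A"
    and y: "H_eigenpair k N A \<mu> y"
    and x: "H_eigenpair k N A \<kappa> x" and pos: "\<And>i. i \<in> N \<Longrightarrow> 0 < x i"
  shows "\<mu> \<le> \<kappa>"
proof -
  obtain i0 where i0: "i0 \<in> N" "y i0 \<noteq> 0"
    using y unfolding H_eigenpair_def by blast
  define t where "t = Max ((\<lambda>i. \<bar>y i\<bar> / x i) ` N)"
  have "t \<in> (\<lambda>i. \<bar>y i\<bar> / x i) ` N"
    unfolding t_def using fin i0 by (intro Max_in) auto
  then obtain i where i: "i \<in> N" "t = \<bar>y i\<bar> / x i"
    by blast
  have le: "\<bar>y j\<bar> / x j \<le> t" if "j \<in> N" for j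
    unfolding t_def using fin that by simp
  then have ytx: "\<bar>y j\<bar> \<le> t * x j" if "j \<in> N" for j
    using that pos[OF that] by (simp add: divide_le_eq)
  have "0 < \<bar>y i0\<bar> / x i0"
    using i0 pos by simp
  then have tpos: "0 < t"
    using le[OF i0(1)] by linarith
  have yi: "\<bar>y i\<bar> = t * x i"
    using i pos by (simp add: less_imp_neq[symmetric])
  \<comment> \<open>The absolute value also covers negative \<open>\<mu>\<close> and negative
    \<open>y i\<close>.\<close>
  have "\<mu> * (t * x i) ^ (k - 1) \<le> \<bar>\<mu> * y i ^ (k - 1)\<bar>"
    unfolding yi[symmetric] by (simp add: abs_mult power_abs mult_right_mono)
  also have "\<dots> = \<bar>tensor_apply k N A y i\<bar>"
    using y i unfolding H_eigenpair_def by simp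
  also have "\<dots> \<le> (\<Sum>is \<in> tuples (k - 1) N. \<bar>A (i # is) * prod_list (map y is)\<bar>)"
    unfolding tensor_apply_def by (rule sum_abs)
  also have "\<dots> \<le> (\<Sum>is \<in> tuples (k - 1) N. t ^ (k - 1) * (A (i # is) * prod_list (map x is)))"
  proof (rule sum_mono)
    fix "is" assume mem: "is \<in> tuples (k - 1) N"
    then have A: "0 \<le> A (i # is)"
      using nn i k by (simp add: nonneg_tensor_def tuples_Cons_iff)
    have "prod_list (map (\<lambda>i. \<bar>y i\<bar>) is) \<le> prod_list (map (\<lambda>i. t * x i) is)"
      using mem ytx by (intro prod_list_map_mono) (auto simp: tuples_def)
    also have "\<dots> = t ^ (k - 1) * prod_list (map x is)"
      using mem by (simp add: prod_list_map_cmult tuples_def)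
    finally show "\<bar>A (i # is) * prod_list (map y is)\<bar>
        \<le> t ^ (k - 1) * (A (i # is) * prod_list (map x is))"
      using A mult_left_mono[OF _ A]
      by (fastforce simp: abs_mult abs_prod_list_map mult.left_commute)
  qed
  also have "\<dots> = t ^ (k - 1) * tensor_apply k N A x i"
    by (simp add: tensor_apply_def sum_distrib_left)
  also have "\<dots> = \<kappa> * (t * x i) ^ (k - 1)"
    using x i(1) unfolding H_eigenpair_def by (simp add: power_mult_distrib)
  finally show ?thesis
    using tpos pos[OF i(1)] by simp
qed

text \<open>The positive eigenvector shows that the maximum behind \<open>GREATEST\<close> is
  attained, so \<open>lambda_max\<close> has its intended meaning here. Two such eigenvalues
  therefore coincide.\<close>

lemma Hpp_eigenvalue_eq_lambda_max:
  assumes "finite N" "k \<ge> 1" "nonneg_tensor k N A" "Hpp_eigenvalue k N A \<mu>"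
  shows "lambda_max k N A = \<mu>"
  unfolding lambda_max_def
proof (rule Greatest_equality)
  show "H_eigenvalue k N A \<mu>"
    using assms(4) unfolding H_eigenvalue_def Hpp_eigenvalue_def by blast
  show "\<nu> \<le> \<mu>" if "H_eigenvalue k N A \<nu>" for \<nu>
    using that assms H_eigenvalue_le_of_positive_eigenvector
    unfolding H_eigenvalue_def Hpp_eigenvalue_def by metis
qed

section \<open>The homogeneous form of a symmetric tensor\<close>

definition tensor_form :: "nat \<Rightarrow> 'a set \<Rightarrow> 'a tensor \<Rightarrow> ('a \<Rightarrow> real) \<Rightarrow> real" where
  "tensor_form k N A x = (\<Sum>is \<in> tuples k N. A is * prod_list (map x is))"

lemma tensor_form_cong:
  "(\<And>i. i \<in> N \<Longrightarrow> x i = y i) \<Longrightarrow> tensor_form k N A x = tensor_form k N A y"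
  unfolding tensor_form_def tuples_def
  by (intro sum.cong arg_cong2[where f = "(*)"] arg_cong[where f = prod_list] map_cong) auto

lemma tensor_form_cmult: "tensor_form k N A (\<lambda>i. c * x i) = c ^ k * tensor_form k N A x"
  unfolding tensor_form_def sum_distrib_left
  by (intro sum.cong) (auto simp: prod_list_map_cmult tuples_def)

lemma continuous_on_prod_list_map:
  "continuous_on UNIV (\<lambda>x :: 'a \<Rightarrow> real. prod_list (map x is))"
  by (induction "is") (auto intro!: continuous_intros)

lemma continuous_on_tensor_form: "continuous_on UNIV (tensor_form k N A)"
  unfolding tensor_form_def
  by (intro continuous_intros continuous_on_prod_list_map)

text \<open>This is Tychonoff's theorem, transferred to the topology of the function type.\<close>

lemma compact_function_box:
  fixes B :: "'a \<Rightarrow> real set"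
  assumes "\<And>i. compact (B i)"
  shows "compact (PiE UNIV B)"
proof -
  have "compactin (product_topology (\<lambda>_. euclidean) UNIV) (PiE UNIV B)"
    using assms by (simp add: compactin_PiE)
  then show ?thesis
    by (simp add: euclidean_product_topology)
qed

text \<open>The form is maximized over a compact piece of the \<open>k\<close>-norm unit sphere.
  Since form and constraint are both homogeneous of degree \<open>k\<close>, maximality extends to
  an inequality on the whole nonnegative orthant, where competitors need no normalization.\<close>

lemma tensor_form_maximizer:
  assumes fin: "finite N" and ne: "N \<noteq> {}" and k: "k \<ge> 1"
  obtains x where "\<And>i. i \<in> N \<Longrightarrow> 0 \<le> x i" "(\<Sum>i\<in>N. x i ^ k) = 1"
    "\<And>y. (\<And>i. i \<in> N \<Longrightarrow> 0 \<le> y i) \<Longrightarrow>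
      tensor_form k N A y \<le> tensor_form k N A x * (\<Sum>i\<in>N. y i ^ k)"
proof -
  \<comment> \<open>Vectors are functions on the whole type, so coordinates outside \<open>N\<close>
    are pinned to 0 to make the box compact. On \<open>N\<close> the bound 1 already follows from
    the constraint and nonnegativity.\<close>
  define B where "B i = (if i \<in> N then {0..1} else {0 :: real})" for i
  define S where "S = PiE UNIV B \<inter> {x. (\<Sum>i\<in>N. x i ^ k) = 1}"
  have "compact S"
    unfolding S_def
  proof (rule compact_Int_closed)
    show "compact (PiE UNIV B)"
      by (rule compact_function_box) (simp add: B_def)
    show "closed {x :: 'a \<Rightarrow> real. (\<Sum>i\<in>N. x i ^ k) = 1}"
      by (intro closed_Collect_eq continuous_intros) auto
  qed
  moreover have "S \<noteq> {}"
  proof -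
    obtain a where "a \<in> N" using ne by blast
    have "(\<Sum>i\<in>N. (if i = a then 1 else 0 :: real) ^ k) = (\<Sum>i\<in>N. if i = a then 1 else 0)"
      using k by (intro sum.cong) auto
    then have "(\<lambda>i. if i = a then 1 else 0) \<in> S"
      using \<open>a \<in> N\<close> fin by (auto simp: S_def B_def)
    then show ?thesis by blast
  qed
  ultimately obtain x where x: "x \<in> S" "\<And>z. z \<in> S \<Longrightarrow> tensor_form k N A z \<le> tensor_form k N A x"
    using continuous_attains_sup[of S "tensor_form k N A"]
      continuous_on_subset[OF continuous_on_tensor_form] by blast
  have xB: "x i \<in> B i" for i
    using x(1) by (auto simp: S_def PiE_iff)
  show thesis
  proof (rule that)
    show "0 \<le> x i" if "i \<in> N" for i
      using xB[of i] that by (auto simp: B_def)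
    show "(\<Sum>i\<in>N. x i ^ k) = 1"
      using x(1) by (simp add: S_def)
  next
    fix y :: "'a \<Rightarrow> real" assume y: "\<And>i. i \<in> N \<Longrightarrow> 0 \<le> y i"
    define c where "c = (\<Sum>i\<in>N. y i ^ k)"
    have le_c: "y i ^ k \<le> c" if "i \<in> N" for i
      unfolding c_def using that fin y by (intro member_le_sum) auto
    have "0 \<le> c"
      unfolding c_def using y by (simp add: sum_nonneg)
    show "tensor_form k N A y \<le> tensor_form k N A x * (\<Sum>i\<in>N. y i ^ k)"
    proof (cases "c = 0")
      case True
      \<comment> \<open>Writing the zero vector as a multiple of \<open>x\<close> lets
        \<open>tensor_form_cmult\<close> evaluate the form as \<open>0 ^ k\<close> times a
        number.\<close>
      have y0: "y i = 0 * x i" if "i \<in> N" for i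
      proof -
        have "y i ^ k \<le> 0" "0 \<le> y i ^ k"
          using le_c[OF that] y[OF that] True by auto
        then have "y i ^ k = 0"
          by (rule antisym)
        then show ?thesis by simp
      qed
      have "tensor_form k N A y = tensor_form k N A (\<lambda>i. 0 * x i)"
        using y0 by (rule tensor_form_cong)
      also have "\<dots> = 0"
        using k by (simp only: tensor_form_cmult) simp
      finally show ?thesis
        using True by (simp add: c_def)
    next
      case False
      \<comment> \<open>\<open>r\<close> is the \<open>k\<close>-norm of \<open>y\<close> on
        \<open>N\<close>; \<open>z\<close> below is \<open>y\<close> rescaled to norm 1 and cut off
        outside \<open>N\<close>, as membership in \<open>S\<close> demands.\<close>
      define r where "r = root k c"
      have r: "0 < r" "r ^ k = c"
        using False \<open>0 \<le> c\<close> k by (auto simp: r_def)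
      define z where "z i = (if i \<in> N then inverse r * y i else 0)" for i
      have "z i \<in> B i" for i
      proof (cases "i \<in> N")
        case True
        have "y i \<le> r"
          using le_c[OF True] r y[OF True] k power_mono_iff[of "y i" r k] by simp
        then show ?thesis
          using True y[OF True] r by (simp add: z_def B_def field_simps)
      qed (simp add: z_def B_def)
      moreover have "(\<Sum>i\<in>N. z i ^ k) = inverse r ^ k * c"
        by (simp add: z_def c_def sum_distrib_left power_mult_distrib)
      ultimately have "z \<in> S"
        using r False by (simp add: S_def PiE_iff power_inverse)
      then have "tensor_form k N A z \<le> tensor_form k N A x"
        by (rule x(2))
      moreover have "tensor_form k N A z = tensor_form k N A (\<lambda>i. inverse r * y i)"
        by (rule tensor_form_cong) (simp add: z_def)
      ultimately have "inverse c * tensor_form k N A y \<le> tensor_form k N A x"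
        using r by (simp add: tensor_form_cmult power_inverse)
      then show ?thesis
        using False \<open>0 \<le> c\<close> by (simp add: c_def[symmetric] field_simps)
    qed
  qed
qed

section \<open>Partial derivatives of the form\<close>

text \<open>Product rule: each occurrence of \<open>i\<close> in the list contributes the product
  with that position deleted.\<close>

lemma has_real_derivative_prod_list_upd:
  fixes x :: "'a \<Rightarrow> real"
  shows "((\<lambda>t. prod_list (map (x(i := t)) is)) has_real_derivative
    (\<Sum>j<length is. if is ! j = i then prod_list (map x (take j is @ drop (Suc j) is)) else 0))
    (at (x i))"
proof (induction "is")
  case (Cons a "is")
  have "((\<lambda>t. (x(i := t)) a) has_real_derivative (if a = i then 1 else 0)) (at (x i))"
    by (auto intro!: derivative_eq_intros)
  from DERIV_mult[OF this Cons.IH] show ?case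
    by (auto simp: sum.lessThan_Suc_shift sum_distrib_left if_distrib mult_ac
        simp del: sum.lessThan_Suc cong: if_cong elim!: back_subst[of "\<lambda>d. DERIV _ _ :> d"])
qed simp

text \<open>By symmetry the index \<open>i\<close> contributes equally at each of the \<open>k\<close> positions.\<close>
lemma has_real_derivative_tensor_form_upd:
  assumes fin: "finite N" and k: "k \<ge> 1" and sym: "symmetric_tensor k N A" and i: "i \<in> N"
  shows "((\<lambda>t. tensor_form k N A (x(i := t))) has_real_derivative
    (real k * tensor_apply k N A x i)) (at (x i))"
proof -
  let ?P = "\<lambda>j is. prod_list (map x (take j is @ drop (Suc j) is))"
  have "(\<Sum>is \<in> tuples k N. A is * (\<Sum>j<length is. if is ! j = i then ?P j is else 0)) =
      (\<Sum>is \<in> tuples k N. \<Sum>j<k. if is ! j = i then A is * ?P j is else 0)"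
    by (intro sum.cong) (auto simp: tuples_def sum_distrib_left intro!: sum.cong)
  also have "\<dots> = (\<Sum>j<k. \<Sum>is \<in> tuples k N. if is ! j = i then A is * ?P j is else 0)"
    by (rule sum.swap)
  also have "\<dots> = (\<Sum>j<k. tensor_apply k N A x i)"
  proof (rule sum.cong)
    fix j assume "j \<in> {..<k}"
    then have j: "j < k" by simp
    have "(\<Sum>is \<in> tuples k N. if is ! j = i then A is * ?P j is else 0) =
        (\<Sum>is \<in> {is \<in> tuples k N. is ! j = i}. A is * ?P j is)"
      using fin by (simp add: sum.If_cases Int_def)
    also have "\<dots> = (\<Sum>is \<in> tuples (k - 1) N. A (i # is) * prod_list (map x is))"
    \<comment> \<open>Tuples with \<open>i\<close> at position \<open>j\<close> correspond to
      shorter tuples by deleting, respectively inserting, that entry. Symmetry allows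
      \<open>i\<close> to be read at the front instead.\<close>
    proof (rule sum.reindex_bij_witness[where
          i = "\<lambda>is. take j is @ i # drop j is" and j = "\<lambda>is. take j is @ drop (Suc j) is"])
      fix "is" assume "is \<in> {is \<in> tuples k N. is ! j = i}"
      then have mem: "is \<in> tuples k N" "is ! j = i" "length is = k"
        by (auto simp: tuples_def)
      then have split: "take j is @ i # drop (Suc j) is = is"
        using j by (metis id_take_nth_drop)
      show "take j (take j is @ drop (Suc j) is) @ i # drop j (take j is @ drop (Suc j) is) = is"
        using mem j split by simp
      show "take j is @ drop (Suc j) is \<in> tuples (k - 1) N"
        using mem j by (auto simp: tuples_def dest: in_set_takeD in_set_dropD)
      have "mset (i # take j is @ drop (Suc j) is) = mset is"
        by (subst (3) split[symmetric]) simp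
      then have "A (i # take j is @ drop (Suc j) is) = A is"
        by (rule symmetric_tensor_mset_cong[OF sym mem(1)])
      then show "A (i # take j is @ drop (Suc j) is) * prod_list (map x (take j is @ drop (Suc j) is)) =
          A is * ?P j is"
        by simp
    next
      fix "is" assume mem: "is \<in> tuples (k - 1) N"
      then show "take j (take j is @ i # drop j is) @ drop (Suc j) (take j is @ i # drop j is) = is"
        using j by (auto simp: tuples_def)
      show "take j is @ i # drop j is \<in> {is \<in> tuples k N. is ! j = i}"
        using mem j i by (auto simp: tuples_def nth_append dest: in_set_takeD in_set_dropD)
    qed
    finally show "(\<Sum>is \<in> tuples k N. if is ! j = i then A is * ?P j is else 0) =
        tensor_apply k N A x i"
      by (simp add: tensor_apply_def)
  qed simp
  finally have eq: "(\<Sum>is \<in> tuples k N. A is *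
      (\<Sum>j<length is. if is ! j = i then ?P j is else 0)) = real k * tensor_apply k N A x i"
    by simp
  show ?thesis
    unfolding tensor_form_def eq[symmetric]
    by (intro DERIV_sum DERIV_cmult has_real_derivative_prod_list_upd)
qed

section \<open>Perron--Frobenius for weakly irreducible symmetric tensors\<close>

lemma rtrancl_crossing_edge:
  assumes "(u, v) \<in> E\<^sup>*" "P u" "\<not> P v"
  obtains a b where "(a, b) \<in> E" "P a" "\<not> P b"
  using assms by (induction rule: rtrancl_induct) blast+

text \<open>Vertices are classified by whether their second component lies in \<open>J\<close>. A
  path between the copies of \<open>p\<close> and \<open>q\<close> in layer 0 has an edge leaving
  the class, and the tuple witnessing that edge meets both \<open>J\<close> and its
  complement.\<close>

lemma weakly_irreducible_crossing_tuple:
  assumes wi: "weakly_irreducible k N A" and k: "k \<ge> 1"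
    and p: "p \<in> N" "p \<in> J" and q: "q \<in> N" "q \<notin> J"
  obtains "is" where "is \<in> tuples k N" "A is \<noteq> 0" "set is \<inter> J \<noteq> {}" "\<not> set is \<subseteq> J"
proof -
  have path: "((0, p), (0, q)) \<in> (tensor_graph_edges k N A)\<^sup>*"
    using wi k p q unfolding weakly_irreducible_def tensor_graph_verts_def by auto
  obtain u v where "(u, v) \<in> tensor_graph_edges k N A" "snd u \<in> J" "snd v \<notin> J"
    by (rule rtrancl_crossing_edge[OF path, of "\<lambda>u. snd u \<in> J"]) (use p q in auto)
  then obtain j p' l q' "is" where "j < k" "l < k" "is \<in> tuples k N" "is ! j = p'" "is ! l = q'"
      "A is \<noteq> 0" "p' \<in> J" "q' \<notin> J"
    unfolding tensor_graph_edges_def by auto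
  then show thesis
    by (intro that[of "is"]) (auto simp: tuples_def dest: nth_mem)
qed

text \<open>Raising the zero coordinates of a maximizer \<open>x\<close> to \<open>\<epsilon>\<close> changes \<open>\<Sum>x\<^sub>i\<^sup>k\<close> only by
  \<open>O(\<epsilon>\<^sup>k)\<close>, whereas an entry with indices both inside and outside the zero set contributes a
  multiple of \<open>\<epsilon>\<^sup>m\<close> with \<open>m < k\<close> to the form.\<close>
lemma tensor_form_maximizer_pos:
  assumes fin: "finite N" and k: "k \<ge> 1" and nn: "nonneg_tensor k N A"
    and wi: "weakly_irreducible k N A"
    and x: "\<And>i. i \<in> N \<Longrightarrow> 0 \<le> x i" "(\<Sum>i\<in>N. x i ^ k) = 1"
    and max: "\<And>y. (\<And>i. i \<in> N \<Longrightarrow> 0 \<le> y i) \<Longrightarrow>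
      tensor_form k N A y \<le> tensor_form k N A x * (\<Sum>i\<in>N. y i ^ k)"
    and p: "p \<in> N"
  shows "0 < x p"
proof (rule ccontr)
  assume "\<not> 0 < x p"
  then have xp: "x p = 0"
    using x(1)[OF p] by simp
  define J where "J = {i \<in> N. x i = 0}"
  have "\<exists>q\<in>N. x q \<noteq> 0"
  proof (rule ccontr)
    assume "\<not> (\<exists>q\<in>N. x q \<noteq> 0)"
    then have "(\<Sum>i\<in>N. x i ^ k) = 0"
      using k by (intro sum.neutral) auto
    then show False using x(2) by simp
  qed
  then obtain q where q: "q \<in> N" "x q \<noteq> 0" by blast
  obtain w where w: "w \<in> tuples k N" "A w \<noteq> 0" "set w \<inter> J \<noteq> {}" "\<not> set w \<subseteq> J"
    using weakly_irreducible_crossing_tuple[OF wi k, of p J q] p q xp unfolding J_def by auto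
  define C where "C = prod_list (map x (filter (\<lambda>i. i \<notin> J) w))"
  have "0 < C"
    unfolding C_def
  proof (rule prod_list_map_pos)
    fix i assume "i \<in> set (filter (\<lambda>i. i \<notin> J) w)"
    then have "i \<in> N" "x i \<noteq> 0"
      using w(1) by (auto simp: J_def tuples_def)
    then show "0 < x i"
      using x(1)[of i] by simp
  qed
  have "0 < A w"
    using nn w by (simp add: nonneg_tensor_def order_less_le)
  define \<kappa> where "\<kappa> = tensor_form k N A x"
  define m where "m = length (filter (\<lambda>i. i \<in> J) w)"
  have "m < k"
  proof -
    obtain a where "a \<in> set w" "a \<notin> J" using w(4) by blast
    then show ?thesis
      using w(1) length_filter_less[of a w "\<lambda>i. i \<in> J"] by (simp add: m_def tuples_def)
  qed
  \<comment> \<open>Comparing \<open>x\<close> with its perturbation and dividing by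
    \<open>\<epsilon> ^ m\<close> leaves a fixed positive number on the left and a bound linear in
    \<open>\<epsilon>\<close> on the right, which fails for small \<open>\<epsilon>\<close>.\<close>
  have gain: "A w * C \<le> \<kappa> * card J * \<epsilon>" if \<epsilon>: "0 < \<epsilon>" "\<epsilon> \<le> 1" for \<epsilon>
  proof -
    define y where "y i = (if i \<in> J then \<epsilon> else x i)" for i
    have y: "0 \<le> y i" "x i \<le> y i" if "i \<in> N" for i
      using x(1)[OF that] that \<epsilon> by (auto simp: y_def J_def)
    have term_mono: "A is * prod_list (map x is) \<le> A is * prod_list (map y is)"
      if "is \<in> tuples k N" for "is"
      using that nn x(1) y by (intro mult_left_mono prod_list_map_mono)
        (auto simp: tuples_def nonneg_tensor_def)
    \<comment> \<open>The entry at \<open>w\<close> is invisible to \<open>x\<close> but contributes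
      to the perturbed vector; all other terms can only grow.\<close>
    have "prod_list (map x w) = 0"
      using w(3) by (auto simp: prod_list_zero_iff J_def image_iff)
    moreover have "prod_list (map y w) = \<epsilon> ^ m * C"
      unfolding y_def prod_list_map_if C_def m_def by (simp add: map_replicate_const)
    ultimately have "tensor_form k N A x + A w * (\<epsilon> ^ m * C) =
        A w * prod_list (map y w) + (\<Sum>is \<in> tuples k N - {w}. A is * prod_list (map x is))"
      unfolding tensor_form_def using fin w(1) by (simp add: sum.remove)
    also have "\<dots> \<le> A w * prod_list (map y w) +
        (\<Sum>is \<in> tuples k N - {w}. A is * prod_list (map y is))"
      using term_mono by (intro add_left_mono sum_mono) auto
    also have "\<dots> = tensor_form k N A y"
      unfolding tensor_form_def using fin w(1) by (simp add: sum.remove)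
    also have "\<dots> \<le> \<kappa> * (\<Sum>i\<in>N. y i ^ k)"
      unfolding \<kappa>_def using y(1) by (rule max)
    also have "(\<Sum>i\<in>N. y i ^ k) = (\<Sum>i\<in>N. x i ^ k + (if i \<in> J then \<epsilon> ^ k else 0))"
      using k by (intro sum.cong) (auto simp: y_def J_def)
    also have "\<dots> = 1 + card J * \<epsilon> ^ k"
    proof -
      have "N \<inter> J = J" by (auto simp: J_def)
      then show ?thesis
        using fin x(2) by (simp add: sum.distrib sum.If_cases)
    qed
    finally have "A w * C * \<epsilon> ^ m \<le> \<kappa> * card J * \<epsilon> ^ k"
      by (simp add: \<kappa>_def algebra_simps)
    also have "\<epsilon> ^ k = \<epsilon> ^ (k - m) * \<epsilon> ^ m"
      using \<open>m < k\<close> by (simp flip: power_add)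
    finally have "A w * C \<le> \<kappa> * card J * \<epsilon> ^ (k - m)"
      using \<epsilon> by (simp flip: mult.assoc)
    also have "\<dots> \<le> \<kappa> * card J * \<epsilon>"
    proof (rule mult_left_mono)
      show "\<epsilon> ^ (k - m) \<le> \<epsilon>"
        using power_decreasing[of 1 "k - m" \<epsilon>] \<epsilon> \<open>m < k\<close> by simp
      have "0 \<le> \<kappa>"
        unfolding \<kappa>_def tensor_form_def using nn x(1)
        by (intro sum_nonneg mult_nonneg_nonneg prod_list_nonneg)
          (auto simp: tuples_def nonneg_tensor_def)
      then show "0 \<le> \<kappa> * card J" by simp
    qed
    finally show ?thesis .
  qed
  have D: "0 < A w * C"
    using \<open>0 < A w\<close> \<open>0 < C\<close> by simp
  then have K: "0 < \<kappa> * card J"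
    using gain[of 1] by simp
  \<comment> \<open>This choice makes the right-hand side of \<open>gain\<close> at most half of its
    left-hand side.\<close>
  define \<epsilon> where "\<epsilon> = min 1 (A w * C / (2 * (\<kappa> * card J)))"
  have "0 < \<epsilon>" "\<epsilon> \<le> 1" "\<epsilon> \<le> A w * C / (2 * (\<kappa> * card J))"
    using D K by (auto simp: \<epsilon>_def)
  then have "\<kappa> * card J * \<epsilon> \<le> A w * C / 2"
    using K by (simp add: field_simps)
  then show False
    using gain[OF \<open>0 < \<epsilon>\<close> \<open>\<epsilon> \<le> 1\<close>] D by linarith
qed

text \<open>The maximal value \<open>\<kappa>\<close> of the form serves as Lagrange multiplier: by
  the homogenized inequality, the form minus \<open>\<kappa>\<close> times the \<open>k\<close>-th
  power sum is at most 0 on the nonnegative orthant and equals 0 at \<open>x\<close>, so its partial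
  derivatives vanish at the positive point \<open>x\<close>.\<close>

lemma weakly_irreducible_Hpp_eigenvalue:
  assumes fin: "finite N" and ne: "N \<noteq> {}" and k: "k \<ge> 1"
    and sym: "symmetric_tensor k N A" and nn: "nonneg_tensor k N A"
    and wi: "weakly_irreducible k N A"
  shows "\<exists>\<mu>. Hpp_eigenvalue k N A \<mu>"
proof -
  obtain x where x: "\<And>i. i \<in> N \<Longrightarrow> 0 \<le> x i" "(\<Sum>i\<in>N. x i ^ k) = 1"
    and max: "\<And>y. (\<And>i. i \<in> N \<Longrightarrow> 0 \<le> y i) \<Longrightarrow>
      tensor_form k N A y \<le> tensor_form k N A x * (\<Sum>i\<in>N. y i ^ k)"
    using tensor_form_maximizer[OF fin ne k] by blast
  have pos: "0 < x i" if "i \<in> N" for i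
    using tensor_form_maximizer_pos[OF fin k nn wi x max that] .
  define \<kappa> where "\<kappa> = tensor_form k N A x"
  have "tensor_apply k N A x i = \<kappa> * x i ^ (k - 1)" if i: "i \<in> N" for i
  proof -
    let ?g = "\<lambda>t. tensor_form k N A (x(i := t)) - \<kappa> * (\<Sum>j\<in>N. (x(i := t)) j ^ k)"
    have "(\<Sum>j\<in>N. (x(i := t)) j ^ k) = t ^ k + (\<Sum>j\<in>N - {i}. x j ^ k)" for t
      using fin i by (simp add: sum.remove)
    then have "((\<lambda>t. \<Sum>j\<in>N. (x(i := t)) j ^ k) has_real_derivative real k * x i ^ (k - 1))
        (at (x i))"
      by (auto intro!: derivative_eq_intros)
    then have "(?g has_real_derivative
        real k * tensor_apply k N A x i - \<kappa> * (real k * x i ^ (k - 1))) (at (x i))"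
      by (intro DERIV_diff DERIV_cmult has_real_derivative_tensor_form_upd[OF fin k sym i])
    \<comment> \<open>Radius \<open>x i\<close> keeps \<open>t\<close> positive, so the varied
      vector stays in the orthant where \<open>max\<close> applies; this is where positivity of the
      maximizer enters.\<close>
    moreover have "\<forall>t. \<bar>x i - t\<bar> < x i \<longrightarrow> ?g t \<le> ?g (x i)"
    proof (intro allI impI)
      fix t assume "\<bar>x i - t\<bar> < x i"
      then have "tensor_form k N A (x(i := t)) \<le> \<kappa> * (\<Sum>j\<in>N. (x(i := t)) j ^ k)"
        unfolding \<kappa>_def using x(1) by (intro max) auto
      then show "?g t \<le> ?g (x i)"
        using x(2) by (simp add: \<kappa>_def)
    qed
    ultimately have "real k * tensor_apply k N A x i - \<kappa> * (real k * x i ^ (k - 1)) = 0"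
      using pos[OF i] DERIV_local_max by blast
    then show ?thesis
      using k by (simp add: mult.left_commute)
  qed
  moreover have "\<exists>i\<in>N. x i \<noteq> 0"
    using ne pos by fastforce
  ultimately show ?thesis
    using pos unfolding Hpp_eigenvalue_def H_eigenpair_def by blast
qed

section \<open>Block diagonal tensors\<close>

lemma tensor_apply_block:
  assumes fin: "finite N" and MN: "M \<subseteq> N"
    and block: "\<And>is. is \<in> tuples (k - 1) N \<Longrightarrow> \<not> set is \<subseteq> M \<Longrightarrow> A (i # is) = 0"
    and eq: "\<And>j. j \<in> M \<Longrightarrow> x j = y j"
  shows "tensor_apply k N A x i = tensor_apply k M A y i"
  unfolding tensor_apply_def
proof (rule sum.mono_neutral_cong_right)
  show "tuples (k - 1) M \<subseteq> tuples (k - 1) N"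
    using MN by (rule tuples_mono)
  show "\<forall>is \<in> tuples (k - 1) N - tuples (k - 1) M. A (i # is) * prod_list (map x is) = 0"
    using block by (auto simp: tuples_def)
  show "A (i # is) * prod_list (map x is) = A (i # is) * prod_list (map y is)"
    if "is \<in> tuples (k - 1) M" for "is"
  proof -
    have "map x is = map y is"
      using that eq by (intro map_cong) (auto simp: tuples_def)
    then show ?thesis by (simp only:)
  qed
qed (simp add: fin)

text \<open>By \<open>tensor_apply_block\<close> the eigenvalue equation at an index of a block
  involves that block only, so positive eigenvectors can be restricted to blocks and glued from
  them.\<close>

lemma weakly_irreducible_partition_Hpp_iff:
  assumes fin: "finite N" and ne: "N \<noteq> {}" and k: "k \<ge> 1"
    and sym: "symmetric_tensor k N A" and nn: "nonneg_tensor k N A"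
    and part: "weakly_irreducible_partition k N A s I"
  shows "Hpp_eigenvalue k N A \<mu> \<longleftrightarrow> (\<forall>r \<in> {1..s}. \<mu> = lambda_max k (I r) A)"
proof -
  have P: "partition_on N (I ` {1..s})" and inj: "inj_on I {1..s}"
    using part unfolding weakly_irreducible_partition_def by simp_all
  have un: "\<Union> (I ` {1..s}) = N"
    by (rule partition_onD1[OF P, symmetric])
  have dj: "disjoint (I ` {1..s})" and nem: "{} \<notin> I ` {1..s}"
    using P by (rule partition_onD2, rule partition_onD3)
  have block: "A (i # is) = 0"
    if "r \<in> {1..s}" "i \<in> I r" "is \<in> tuples (k - 1) N" "\<not> set is \<subseteq> I r" for r i "is"
    using that part unfolding weakly_irreducible_partition_def by blast
  have sub: "I r \<subseteq> N" if "r \<in> {1..s}" for r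
    using un that by blast
  have finI: "finite (I r)" if "r \<in> {1..s}" for r
    using sub[OF that] fin finite_subset by blast
  have neI: "I r \<noteq> {}" if "r \<in> {1..s}" for r
    using nem that by force
  have nnI: "nonneg_tensor k (I r) A" if "r \<in> {1..s}" for r
    using nonneg_tensor_subset[OF nn sub[OF that]] .
  show ?thesis
  proof
    assume "Hpp_eigenvalue k N A \<mu>"
    then obtain x where x: "\<And>i. i \<in> N \<Longrightarrow> tensor_apply k N A x i = \<mu> * x i ^ (k - 1)"
        "\<And>i. i \<in> N \<Longrightarrow> 0 < x i"
      unfolding Hpp_eigenvalue_def H_eigenpair_def by blast
    show "\<forall>r \<in> {1..s}. \<mu> = lambda_max k (I r) A"
    proof
      fix r assume r: "r \<in> {1..s}"
      have "tensor_apply k (I r) A x i = \<mu> * x i ^ (k - 1)" if i: "i \<in> I r" for i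
      proof -
        have "tensor_apply k N A x i = tensor_apply k (I r) A x i"
          by (rule tensor_apply_block[OF fin sub[OF r]]) (use block[OF r i] in auto)
        then show ?thesis
          using x(1)[of i] i sub[OF r] by auto
      qed
      moreover have "\<exists>i\<in>I r. x i \<noteq> 0"
        using neI[OF r] x(2) sub[OF r] by fastforce
      ultimately have "Hpp_eigenvalue k (I r) A \<mu>"
        using x(2) sub[OF r] unfolding Hpp_eigenvalue_def H_eigenpair_def by blast
      then show "\<mu> = lambda_max k (I r) A"
        using Hpp_eigenvalue_eq_lambda_max[OF finI[OF r] k nnI[OF r]] by simp
    qed
  next
    assume eq: "\<forall>r \<in> {1..s}. \<mu> = lambda_max k (I r) A"
    \<comment> \<open>Weak irreducibility gives the block some positive eigenvector; its eigenvalue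
      is the block's \<open>lambda_max\<close>, hence \<open>\<mu>\<close>.\<close>
    have "Hpp_eigenvalue k (I r) A \<mu>" if r: "r \<in> {1..s}" for r
    proof -
      have "weakly_irreducible k (I r) A"
        using part r unfolding weakly_irreducible_partition_def by blast
      then obtain \<nu> where \<nu>: "Hpp_eigenvalue k (I r) A \<nu>"
        using weakly_irreducible_Hpp_eigenvalue[OF finI[OF r] neI[OF r] k
            symmetric_tensor_subset[OF sym sub[OF r]] nnI[OF r]] by blast
      then show ?thesis
        using eq r Hpp_eigenvalue_eq_lambda_max[OF finI[OF r] k nnI[OF r] \<nu>] by simp
    qed
    then have "\<forall>r \<in> {1..s}. \<exists>x. (\<forall>i\<in>I r. 0 < x i \<and>
        tensor_apply k (I r) A x i = \<mu> * x i ^ (k - 1))"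
      unfolding Hpp_eigenvalue_def H_eigenpair_def by blast
    then obtain X where X: "\<And>r i. r \<in> {1..s} \<Longrightarrow> i \<in> I r \<Longrightarrow> 0 < X r i"
        "\<And>r i. r \<in> {1..s} \<Longrightarrow> i \<in> I r \<Longrightarrow>
          tensor_apply k (I r) A (X r) i = \<mu> * X r i ^ (k - 1)"
      unfolding bchoice_iff by blast
    \<comment> \<open>Each index lies in one block by disjointness, and injectivity of
      \<open>I\<close> makes the block's number unique, so \<open>THE\<close> is well defined on
      \<open>N\<close>.\<close>
    define x where "x i = X (THE r. r \<in> {1..s} \<and> i \<in> I r) i" for i
    have x_eq: "x i = X r i" if r: "r \<in> {1..s}" "i \<in> I r" for r i
    proof -
      have "(THE r. r \<in> {1..s} \<and> i \<in> I r) = r"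
      proof (rule the_equality)
        fix r' assume r': "r' \<in> {1..s} \<and> i \<in> I r'"
        then have "I r' = I r"
          using dj r unfolding disjoint_def by blast
        then show "r' = r"
          using inj r r' by (blast dest: inj_onD)
      qed (use r in blast)
      then show ?thesis by (simp add: x_def)
    qed
    have "0 < x i \<and> tensor_apply k N A x i = \<mu> * x i ^ (k - 1)" if i: "i \<in> N" for i
    proof -
      obtain r where r: "r \<in> {1..s}" "i \<in> I r"
        using i un by blast
      have "tensor_apply k N A x i = tensor_apply k (I r) A (X r) i"
        by (rule tensor_apply_block[OF fin sub[OF r(1)]]) (use block[OF r] x_eq[OF r(1)] in auto)
      then show ?thesis
        using X[OF r] x_eq[OF r] by simp
    qed
    moreover from this have "\<exists>i\<in>N. x i \<noteq> 0"
      using ne by fastforce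
    ultimately show "Hpp_eigenvalue k N A \<mu>"
      unfolding Hpp_eigenvalue_def H_eigenpair_def by blast
  qed
qed

theorem theorem4:
  fixes k n :: nat and A :: "nat tensor"
  assumes "k \<ge> 2" and "n \<ge> 1"
    and "symmetric_tensor k {1..n} A" and "nonneg_tensor k {1..n} A"
  shows "(\<exists>\<^sub>\<le>\<^sub>1 \<mu>. Hpp_eigenvalue k {1..n} A \<mu>) \<and>
    (\<forall>s I. weakly_irreducible_partition k {1..n} A s I \<longrightarrow>
      (\<forall>\<mu>. Hpp_eigenvalue k {1..n} A \<mu> \<longleftrightarrow>
        \<mu> = lambda_max k {1..n} A \<and>
        (\<forall>r \<in> {1..s}. lambda_max k {1..n} A = lambda_max k (I r) A)))"
proof -
  have N: "finite {1..n}" "{1..n} \<noteq> {}" and k: "k \<ge> 1"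
    using assms(1,2) by auto
  have max: "lambda_max k {1..n} A = \<mu>" if "Hpp_eigenvalue k {1..n} A \<mu>" for \<mu>
    using Hpp_eigenvalue_eq_lambda_max[OF N(1) k assms(4) that] .
  \<comment> \<open>Uniqueness holds because every candidate equals \<open>lambda_max\<close> of the
    whole tensor; the same fact adds the first equation to the blockwise criterion.\<close>
  then show ?thesis
    using weakly_irreducible_partition_Hpp_iff[OF N k assms(3,4)]
    unfolding Uniq_def by metis
qed

end
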